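(* Let $p\in[1,\infty]$ and let $\varphi$ be an admissible function for $p$ (as defined in the context). Then the topology induced by the metric $d_{p,\varphi}$ on the space $\mathcal I$ of nonempty compact subsets of $\mathbb R^N$ coincides with the topology induced by the Hausdorff distance $d_H$.
   Context: $\mathcal I$ denotes the family of all nonempty compact subsets of $\mathbb R^N$. For nonempty closed $A\subset\mathbb R^N$, $u_A(x)=\inf_{y\in A}|x-y|$ is the distance function. The Hausdorff distance is $d_H(A,B)=\inf\{\delta>0 : B\subset A+D_\delta,\ A\subset B+D_\delta\}$, where $D_\delta$ is the closed ball of radius $\delta$ centered at $0$; equivalently $d_H(A,B)=\sup_{x}|u_A(x)-u_B(x)|$. Given $p\in[1,\infty]$, a function $\varphi:[0,\infty)\to(0,\infty)$ is admissible for $p$ if it is strictly decreasing, of class $C^1$, the function $x\mapsto\varphi(|x|)$ belongs to $L^p(\mathbb R^N)$, and, when $p=\infty$, additionally $\lim_{t\to\infty}\varphi(t)=0$. For $A,B\in\mathcal I$, $d_{p,\varphi}(A,B)=\|\varphi\circ u_A-\varphi\circ u_B\|_{L^p(\mathbb R^N)}$ (this is a metric on $\mathcal I$). *)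

theory Defs
  imports "HOL-Analysis.Analysis" "HOL-Library.Set_Algebras" "HOL-Probability.Essential_Supremum"
begin

definition Lp_space :: "'a measure \<Rightarrow> ennreal \<Rightarrow> ('a \<Rightarrow> real) set" where
  "Lp_space M p =
     {f \<in> borel_measurable M.
        if p = \<infinity> then esssup M (\<lambda>x. ennreal \<bar>f x\<bar>) < \<infinity>
        else (\<integral>\<^sup>+ x. ennreal (\<bar>f x\<bar> powr enn2real p) \<partial>M) < \<infinity>}"

text \<open>Only meaningful for \<open>f\<close> in \<^term>\<open>Lp_space M p\<close>: an infinite integral or essential
  supremum is sent to \<open>0\<close> by \<^const>\<open>enn2real\<close>.\<close>

definition Lp_norm :: "'a measure \<Rightarrow> ennreal \<Rightarrow> ('a \<Rightarrow> real) \<Rightarrow> real" where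
  "Lp_norm M p f =
     (if p = \<infinity> then enn2real (esssup M (\<lambda>x. ennreal \<bar>f x\<bar>))
      else enn2real (\<integral>\<^sup>+ x. ennreal (\<bar>f x\<bar> powr enn2real p) \<partial>M) powr (1 / enn2real p))"

definition nonempty_compacts :: "(real ^ 'n) set set" where
  "nonempty_compacts = {A. compact A \<and> A \<noteq> {}}"

text \<open>\<open>A + cball 0 \<delta>\<close> is the Minkowski sum.\<close>

definition hausdorff_distance :: "(real ^ 'n) set \<Rightarrow> (real ^ 'n) set \<Rightarrow> real" where
  "hausdorff_distance A B =
     Inf {\<delta>. \<delta> > 0 \<and> B \<subseteq> A + cball 0 \<delta> \<and> A \<subseteq> B + cball 0 \<delta>}"

text \<open>A function \<open>\<phi> : [0,\<infinity>) \<rightarrow> (0,\<infinity>)\<close> is represented by a total function on the reals whose values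
  at negative arguments are irrelevant; in particular the derivative at \<open>0\<close> is one-sided.
  The type argument fixes the dimension of the space on which \<open>x \<mapsto> \<phi> |x|\<close> is considered.\<close>

definition admissible :: "'n::finite itself \<Rightarrow> ennreal \<Rightarrow> (real \<Rightarrow> real) \<Rightarrow> bool" where
  "admissible N p \<phi> \<longleftrightarrow>
     (\<forall>t\<ge>0. \<phi> t > 0) \<and>
     strict_antimono_on {0..} \<phi> \<and>
     (\<exists>\<phi>'. continuous_on {0..} \<phi>' \<and>
           (\<forall>t\<ge>0. (\<phi> has_real_derivative \<phi>' t) (at t within {0..}))) \<and>
     (\<lambda>x :: real ^ 'n. \<phi> (norm x)) \<in> Lp_space lborel p \<and>
     (p = \<infinity> \<longrightarrow> (\<phi> \<longlongrightarrow> 0) at_top)"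

definition dist_Lp ::
    "ennreal \<Rightarrow> (real \<Rightarrow> real) \<Rightarrow> (real ^ 'n) set \<Rightarrow> (real ^ 'n) set \<Rightarrow> real" where
  "dist_Lp p \<phi> A B = Lp_norm lborel p (\<lambda>x. \<phi> (infdist x A) - \<phi> (infdist x B))"

text \<open>The defining facts of \<^const>\<open>Metric_space.mtopology\<close> presuppose the axioms of the locale
  \<^locale>\<open>Metric_space\<close>, which also constrain the distance off the carrier (where
  \<^const>\<open>hausdorff_distance\<close> may be the infimum of the empty set). The following is the same
  topology, defined for any distance function.\<close>

definition metric_topology :: "'a set \<Rightarrow> ('a \<Rightarrow> 'a \<Rightarrow> real) \<Rightarrow> 'a topology" where
  "metric_topology M d =
     topology (\<lambda>U. U \<subseteq> M \<and> (\<forall>x\<in>U. \<exists>r>0. {y \<in> M. d x y < r} \<subseteq> U))"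

lemma openin_metric_topology:
  "openin (metric_topology M d) U \<longleftrightarrow>
     U \<subseteq> M \<and> (\<forall>x\<in>U. \<exists>r>0. {y \<in> M. d x y < r} \<subseteq> U)"
proof -
  let ?P = "\<lambda>U. U \<subseteq> M \<and> (\<forall>x\<in>U. \<exists>r>0. {y \<in> M. d x y < r} \<subseteq> U)"
  have "istopology ?P"
    unfolding istopology_def
  proof (intro conjI allI impI)
    fix S T assume S: "?P S" and T: "?P T"
    show "S \<inter> T \<subseteq> M" using S by blast
    show "\<forall>x\<in>S \<inter> T. \<exists>r>0. {y \<in> M. d x y < r} \<subseteq> S \<inter> T"
    proof
      fix x assume "x \<in> S \<inter> T"
      then obtain r s where "r > 0" "{y \<in> M. d x y < r} \<subseteq> S"
        and "s > 0" "{y \<in> M. d x y < s} \<subseteq> T"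
        using S T by blast
      then show "\<exists>r>0. {y \<in> M. d x y < r} \<subseteq> S \<inter> T"
        by (intro exI[of _ "min r s"]) auto
    qed
  next
    fix \<K> assume K: "\<forall>K\<in>\<K>. ?P K"
    then show "\<Union>\<K> \<subseteq> M" by blast
    show "\<forall>x\<in>\<Union>\<K>. \<exists>r>0. {y \<in> M. d x y < r} \<subseteq> \<Union>\<K>"
    proof
      fix x assume "x \<in> \<Union>\<K>"
      then obtain K where "K \<in> \<K>" "x \<in> K" by blast
      with K obtain r where "r > 0" "{y \<in> M. d x y < r} \<subseteq> K" by blast
      with \<open>K \<in> \<K>\<close> show "\<exists>r>0. {y \<in> M. d x y < r} \<subseteq> \<Union>\<K>" by blast
    qed
  qed
  then show ?thesis
    unfolding metric_topology_def by (simp add: topology_inverse')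
qed

lemma metric_topology_eq_mtopology:
  assumes "Metric_space M d"
  shows "metric_topology M d = Metric_space.mtopology M d"
proof -
  interpret Metric_space M d by fact
  have "{y \<in> M. d x y < r} = mball x r" if "x \<in> M" for x r
    using that by auto
  then show ?thesis
    unfolding topology_eq openin_metric_topology openin_mtopology
    by (metis subset_iff)
qed

end

theory Submission
  imports Defs
begin

text \<open>
  Write \<open>u\<^sub>A\<close> for the distance function of \<open>A\<close>. The two topologies agree as soon as, around each
  fixed \<open>A\<close>, every ball of one distance contains a ball of the other.

  Hausdorff controls \<open>L\<^sup>p\<close>: a small Hausdorff distance makes \<open>u\<^sub>A\<close> and \<open>u\<^sub>B\<close> uniformly close. For
  \<open>p = \<infinity>\<close> the claim is the uniform continuity of the profile \<open>\<phi>\<close>, which is continuous and tends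
  to \<open>0\<close>. For \<open>p < \<infinity>\<close> it is dominated convergence: if \<open>A\<close> and \<open>B\<close> lie in the ball of radius \<open>c\<close>
  about the origin, then \<open>\<phi> \<circ> u\<^sub>A\<close> and \<open>\<phi> \<circ> u\<^sub>B\<close> are both below \<open>x \<mapsto> \<phi> (max 0 (|x| - c))\<close>. That
  this shifted profile is still in \<open>L\<^sup>p\<close> (\<open>shifted_profile_in_Lp\<close>) follows from
  \<open>|x| - c \<ge> |x| / 2\<close> for \<open>|x| \<ge> 2 c\<close> and the scaling behaviour of Lebesgue measure.

  \<open>L\<^sup>p\<close> controls Hausdorff: if the Hausdorff distance is not small, some point of one set has
  distance at least \<open>e\<close> from the other set. On the whole ball of radius \<open>e / 4\<close> around it one
  distance function is at most \<open>e / 4\<close> and the other at least \<open>3 e / 4\<close>, so by strict monotonicity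
  the integrand is at least \<open>\<phi> (e / 4) - \<phi> (3 e / 4) > 0\<close> there. The volume of this ball depends
  only on \<open>e\<close>, which bounds the \<open>L\<^sup>p\<close> distance from below uniformly.
\<close>

section \<open>Comparing the topologies of two distance functions\<close>

lemma metric_topology_eqI:
  assumes "\<And>x e. x \<in> M \<Longrightarrow> e > 0 \<Longrightarrow> \<exists>r>0. \<forall>y\<in>M. d x y < r \<longrightarrow> d' x y < e"
    and "\<And>x e. x \<in> M \<Longrightarrow> e > 0 \<Longrightarrow> \<exists>r>0. \<forall>y\<in>M. d' x y < r \<longrightarrow> d x y < e"
  shows "metric_topology M d = metric_topology M d'"
proof -
  have *: "\<exists>r>0. {y \<in> M. d1 x y < r} \<subseteq> U"
    if le: "\<And>x e. x \<in> M \<Longrightarrow> e > 0 \<Longrightarrow> \<exists>r>0. \<forall>y\<in>M. d1 x y < r \<longrightarrow> d2 x y < e"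
      and U: "x \<in> M" "\<exists>r>0. {y \<in> M. d2 x y < r} \<subseteq> U"
    for d1 d2 :: "'a \<Rightarrow> 'a \<Rightarrow> real" and x U
  proof -
    from U obtain e where e: "e > 0" "{y \<in> M. d2 x y < e} \<subseteq> U" by blast
    from le[OF U(1) e(1)] obtain r where "r > 0" "\<forall>y\<in>M. d1 x y < r \<longrightarrow> d2 x y < e" by blast
    with e(2) show ?thesis by (intro exI[of _ r]) auto
  qed
  show ?thesis
    unfolding topology_eq openin_metric_topology
  proof (intro allI iffI conjI ballI; elim conjE)
    fix U x assume "U \<subseteq> M" "\<forall>x\<in>U. \<exists>r>0. {y \<in> M. d x y < r} \<subseteq> U" "x \<in> U"
    then show "\<exists>r>0. {y \<in> M. d' x y < r} \<subseteq> U"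
      by (intro *[OF assms(2)]) auto
  next
    fix U x assume "U \<subseteq> M" "\<forall>x\<in>U. \<exists>r>0. {y \<in> M. d' x y < r} \<subseteq> U" "x \<in> U"
    then show "\<exists>r>0. {y \<in> M. d x y < r} \<subseteq> U"
      by (intro *[OF assms(1)]) auto
  qed
qed

section \<open>Domination and lower bounds in \<open>L\<^sup>p\<close>\<close>

lemma enn2real_ge_1:
  assumes "1 \<le> p" "p \<noteq> \<infinity>"
  shows "1 \<le> enn2real p"
  using enn2real_mono[of 1 p] assms by (simp add: less_top)

lemma Lp_space_dominated:
  assumes g: "g \<in> Lp_space M p" and f: "f \<in> borel_measurable M"
    and le: "\<And>x. \<bar>f x\<bar> \<le> g x"
  shows "f \<in> Lp_space M p"
proof (cases "p = \<infinity>")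
  case True
  have "esssup M (\<lambda>x. ennreal \<bar>f x\<bar>) \<le> esssup M (\<lambda>x. ennreal \<bar>g x\<bar>)"
    using f le by (intro esssup_mono) (auto intro!: ennreal_leI intro: order_trans[OF _ abs_ge_self])
  with g f True show ?thesis by (auto simp: Lp_space_def)
next
  case False
  have "(\<integral>\<^sup>+ x. ennreal (\<bar>f x\<bar> powr enn2real p) \<partial>M) \<le> (\<integral>\<^sup>+ x. ennreal (\<bar>g x\<bar> powr enn2real p) \<partial>M)"
    using le by (intro nn_integral_mono ennreal_leI powr_mono2)
      (auto intro: order_trans[OF _ abs_ge_self])
  with g f False show ?thesis by (auto simp: Lp_space_def)
qed

lemma Lp_norm_dominated_convergence:
  fixes f :: "nat \<Rightarrow> 'a \<Rightarrow> real"
  assumes p: "1 \<le> p" "p \<noteq> \<infinity>" and g: "g \<in> Lp_space M p"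
    and f [measurable]: "\<And>n. f n \<in> borel_measurable M"
    and le: "\<And>n x. \<bar>f n x\<bar> \<le> g x"
    and lim: "\<And>x. (\<lambda>n. f n x) \<longlonglongrightarrow> 0"
  shows "(\<lambda>n. Lp_norm M p (f n)) \<longlonglongrightarrow> 0"
proof -
  let ?P = "enn2real p"
  have P: "?P \<ge> 1" by (rule enn2real_ge_1[OF p])
  have [measurable]: "g \<in> borel_measurable M"
    and fin: "(\<integral>\<^sup>+ x. ennreal (\<bar>g x\<bar> powr ?P) \<partial>M) < \<infinity>"
    using g p by (auto simp: Lp_space_def)
  have "(\<lambda>n. \<integral>\<^sup>+ x. ennreal (\<bar>f n x\<bar> powr ?P) \<partial>M) \<longlonglongrightarrow> (\<integral>\<^sup>+ x. 0 \<partial>M)"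
  proof (rule nn_integral_dominated_convergence[OF _ _ _ _ fin])
    show "AE x in M. ennreal (\<bar>f j x\<bar> powr ?P) \<le> ennreal (\<bar>g x\<bar> powr ?P)" for j
      using le P by (intro AE_I2 ennreal_leI powr_mono2) (auto intro: order_trans[OF _ abs_ge_self])
    have "(\<lambda>n. ennreal (\<bar>f n x\<bar> powr ?P)) \<longlonglongrightarrow> ennreal (0 powr ?P)" for x
      using tendsto_rabs[OF lim[of x]] P
      by (intro tendsto_ennrealI tendsto_powr2) auto
    then show "AE x in M. (\<lambda>n. ennreal (\<bar>f n x\<bar> powr ?P)) \<longlonglongrightarrow> 0"
      by simp
  qed auto
  then have "(\<lambda>n. enn2real (\<integral>\<^sup>+ x. ennreal (\<bar>f n x\<bar> powr ?P) \<partial>M)) \<longlonglongrightarrow> enn2real 0"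
    by (intro tendsto_enn2real) auto
  then have "(\<lambda>n. enn2real (\<integral>\<^sup>+ x. ennreal (\<bar>f n x\<bar> powr ?P) \<partial>M) powr (1 / ?P)) \<longlonglongrightarrow> 0 powr (1 / ?P)"
    using P by (intro tendsto_powr2) auto
  then show ?thesis
    using p by (simp add: Lp_norm_def)
qed

text \<open>This is Chebyshev's inequality. It extends to \<open>p = \<infinity>\<close> because the essential supremum sees
  every set of positive measure.\<close>

lemma Lp_norm_ge_on_set:
  assumes p: "1 \<le> p" and f: "f \<in> Lp_space M p"
    and E: "E \<in> sets M" "measure M E > 0"
    and eta: "0 \<le> \<eta>" and ge: "\<And>x. x \<in> E \<Longrightarrow> \<eta> \<le> \<bar>f x\<bar>"
  shows "(if p = \<infinity> then \<eta> else \<eta> * measure M E powr (1 / enn2real p)) \<le> Lp_norm M p f"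
proof (cases "p = \<infinity>")
  case True
  let ?s = "esssup M (\<lambda>x. ennreal \<bar>f x\<bar>)"
  have s: "?s < \<infinity>" using f True by (simp add: Lp_space_def)
  have "ennreal \<eta> \<le> ?s"
  proof (rule ccontr)
    assume less: "\<not> ennreal \<eta> \<le> ?s"
    have "AE x in M. x \<notin> E"
      using esssup_AE[where M = M and f = "\<lambda>x. ennreal \<bar>f x\<bar>"]
    proof (rule AE_mp, intro AE_I2 impI notI)
      fix x assume le: "ennreal \<bar>f x\<bar> \<le> ?s" and x: "x \<in> E"
      show False
        using order_trans[OF ennreal_leI[OF ge[OF x]] le] less by contradiction
    qed
    then have "emeasure M E = 0"
      using E(1) AE_iff_null_sets by blast
    with E(2) show False by (simp add: measure_def)
  qed
  then have "\<eta> \<le> enn2real ?s"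
    using enn2real_mono[of "ennreal \<eta>" ?s] s eta by simp
  then show ?thesis using True by (simp add: Lp_norm_def)
next
  case False
  let ?P = "enn2real p" and ?I = "\<integral>\<^sup>+ x. ennreal (\<bar>f x\<bar> powr enn2real p) \<partial>M"
  have P: "?P \<ge> 1" by (rule enn2real_ge_1[OF p False])
  have fin: "?I < \<infinity>" using f False by (simp add: Lp_space_def)
  have Efin: "emeasure M E = ennreal (measure M E)"
    using E(2) by (metis emeasure_eq_ennreal_measure less_irrefl measure_zero_top)
  have "ennreal (\<eta> powr ?P * measure M E) = (\<integral>\<^sup>+ x. ennreal (\<eta> powr ?P) * indicator E x \<partial>M)"
    using E Efin by (simp add: nn_integral_cmult_indicator ennreal_mult)
  also have "\<dots> \<le> ?I"
    using ge eta P by (intro nn_integral_mono)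
      (auto simp: indicator_def intro!: ennreal_leI powr_mono2)
  finally have "\<eta> powr ?P * measure M E \<le> enn2real ?I"
    using enn2real_mono[of "ennreal (\<eta> powr ?P * measure M E)" ?I] fin by simp
  then have "(\<eta> powr ?P * measure M E) powr (1 / ?P) \<le> enn2real ?I powr (1 / ?P)"
    using P by (intro powr_mono2) auto
  moreover have "(\<eta> powr ?P * measure M E) powr (1 / ?P) = \<eta> * measure M E powr (1 / ?P)"
    using P eta by (simp add: powr_mult powr_powr)
  ultimately show ?thesis using False by (simp add: Lp_norm_def)
qed

lemma nn_integral_lborel_scaleR:
  fixes f :: "'a::euclidean_space \<Rightarrow> ennreal"
  assumes [measurable]: "f \<in> borel_measurable borel" and c: "c \<noteq> 0"
  shows "(\<integral>\<^sup>+ x. f x \<partial>lborel) = ennreal (\<bar>c\<bar> ^ DIM('a)) * (\<integral>\<^sup>+ x. f (c *\<^sub>R x) \<partial>lborel)"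
  by (subst lborel_affine[OF c, of 0])
     (simp add: nn_integral_density nn_integral_distr nn_integral_cmult)

section \<open>The Hausdorff distance and distance functions\<close>

lemma infdist_le_of_subset_Minkowski:
  fixes A B :: "(real ^ 'n) set"
  assumes B: "closed B" "B \<noteq> {}" and sub: "B \<subseteq> A + cball 0 \<delta>"
  shows "infdist x A \<le> infdist x B + \<delta>"
proof -
  obtain b where b: "b \<in> B" "infdist x B = dist x b"
    using infdist_attains_inf[OF B] by blast
  then obtain a d where ad: "a \<in> A" "norm d \<le> \<delta>" "b = a + d"
    using sub by (auto elim!: set_plus_elim dest!: subsetD)
  have "infdist x A \<le> dist x a" using ad by (intro infdist_le)
  also have "\<dots> \<le> dist x b + dist b a" by (rule dist_triangle)
  also have "dist b a \<le> \<delta>" using ad by (simp add: dist_norm)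
  finally show ?thesis using b by simp
qed

lemma subset_Minkowski_cball:
  fixes A B :: "(real ^ 'n) set"
  assumes A: "closed A" "A \<noteq> {}" and le: "\<And>b. b \<in> B \<Longrightarrow> infdist b A \<le> \<delta>"
  shows "B \<subseteq> A + cball 0 \<delta>"
proof
  fix b assume b: "b \<in> B"
  obtain a where a: "a \<in> A" "infdist b A = dist b a"
    using infdist_attains_inf[OF A] by blast
  have "a + (b - a) \<in> A + cball 0 \<delta>"
    using a le[OF b] by (intro set_plus_intro) (auto simp: dist_norm norm_minus_commute)
  then show "b \<in> A + cball 0 \<delta>" by simp
qed

lemma hausdorff_distance_le:
  fixes A B :: "(real ^ 'n) set"
  assumes "closed A" "A \<noteq> {}" "closed B" "B \<noteq> {}" "\<delta> > 0"
    and "\<And>b. b \<in> B \<Longrightarrow> infdist b A \<le> \<delta>" "\<And>a. a \<in> A \<Longrightarrow> infdist a B \<le> \<delta>"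
  shows "hausdorff_distance A B \<le> \<delta>"
  unfolding hausdorff_distance_def
  using assms by (intro cInf_lower bdd_belowI[of _ 0] CollectI conjI subset_Minkowski_cball) auto

lemma bounded_infdist_bound:
  fixes A B :: "'a::euclidean_space set"
  assumes "bounded B" "A \<noteq> {}"
  shows "\<exists>\<delta>>0. \<forall>b\<in>B. infdist b A \<le> \<delta>"
proof -
  obtain a where a: "a \<in> A" using assms by blast
  obtain c where c: "\<And>b. b \<in> B \<Longrightarrow> dist a b \<le> c"
    using assms(1) bounded_any_center[of B a] by blast
  have "infdist b A \<le> max c 1" if "b \<in> B" for b
    using infdist_le[OF a, of b] c[OF that] by (simp add: dist_commute)
  then show ?thesis by (intro exI[of _ "max c 1"]) auto
qed

lemma infdist_diff_le_hausdorff_distance: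
  fixes A B :: "(real ^ 'n) set"
  assumes A: "compact A" "A \<noteq> {}" and B: "compact B" "B \<noteq> {}"
    and less: "hausdorff_distance A B < r"
  shows "\<bar>infdist x A - infdist x B\<bar> \<le> r"
proof -
  let ?S = "{\<delta>. \<delta> > 0 \<and> B \<subseteq> A + cball 0 \<delta> \<and> A \<subseteq> B + cball 0 \<delta>}"
  have cl: "closed A" "closed B" using A B by (auto intro: compact_imp_closed)
  \<comment> \<open>The infimum must not be taken over the empty set: boundedness provides a member.\<close>
  obtain d1 d2 where d: "d1 > 0" "\<forall>b\<in>B. infdist b A \<le> d1" "d2 > 0" "\<forall>a\<in>A. infdist a B \<le> d2"
    using bounded_infdist_bound[of B A] bounded_infdist_bound[of A B] A B
    by (auto dest!: compact_imp_bounded)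
  have "max d1 d2 \<in> ?S"
    using d cl A(2) B(2)
    by (intro CollectI conjI subset_Minkowski_cball) (auto simp: le_max_iff_disj)
  then have "?S \<noteq> {}" by blast
  from cInf_lessD[OF this less[unfolded hausdorff_distance_def]]
  obtain \<delta> where "\<delta> \<in> ?S" "\<delta> < r"
    by blast
  then show ?thesis
    using infdist_le_of_subset_Minkowski[OF cl(2) B(2), of A \<delta> x]
      infdist_le_of_subset_Minkowski[OF cl(1) A(2), of B \<delta> x]
    by auto
qed

section \<open>Profiles composed with distance functions\<close>

lemma norm_minus_radius_le_infdist:
  fixes A :: "'a::euclidean_space set"
  assumes "A \<subseteq> cball 0 c" "A \<noteq> {}"
  shows "norm x - c \<le> infdist x A"
proof (unfold infdist_notempty[OF assms(2)], rule cINF_greatest[OF assms(2)])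
  fix a assume "a \<in> A"
  then have "norm a \<le> c" using assms by auto
  then show "norm x - c \<le> dist x a"
    using norm_triangle_ineq2[of x a] by (simp add: dist_norm)
qed

lemma profile_compose_measurable:
  fixes u :: "'a::euclidean_space \<Rightarrow> real"
  assumes "continuous_on {0..} \<phi>" "continuous_on UNIV u" "\<And>x. u x \<ge> 0"
  shows "(\<lambda>x. \<phi> (u x)) \<in> borel_measurable borel"
  by (rule borel_measurable_continuous_onI, rule continuous_on_compose2[OF assms(1,2)])
    (use assms(3) in auto)

lemma profile_infdist_measurable:
  fixes A :: "'a::euclidean_space set"
  assumes "continuous_on {0..} \<phi>"
  shows "(\<lambda>x. \<phi> (infdist x A)) \<in> borel_measurable borel"
  by (rule profile_compose_measurable[OF assms continuous_on_infdist[OF continuous_on_id]])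
    (rule infdist_nonneg)

text \<open>The shift by \<open>c\<close> is absorbed by halving the argument: outside the ball of radius \<open>2 c\<close> the
  function is at most \<open>\<phi> (|x| / 2)\<close>, and the integral of \<open>\<phi> (|x| / 2)\<^sup>p\<close> is \<open>2\<^sup>N\<close> times that of
  \<open>\<phi> |x|\<^sup>p\<close>; inside this ball it is at most the constant \<open>\<phi> 0\<close>.\<close>

lemma shifted_profile_in_Lp:
  fixes \<phi> :: "real \<Rightarrow> real"
  assumes pos: "\<And>t. t \<ge> 0 \<Longrightarrow> \<phi> t > 0" and mono: "\<And>s t. 0 \<le> s \<Longrightarrow> s \<le> t \<Longrightarrow> \<phi> t \<le> \<phi> s"
    and cont: "continuous_on {0..} \<phi>"
    and Lp: "(\<lambda>x :: 'a::euclidean_space. \<phi> (norm x)) \<in> Lp_space lborel p"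
  shows "(\<lambda>x :: 'a. \<phi> (max 0 (norm x - c))) \<in> Lp_space lborel p"
proof -
  let ?g = "\<lambda>x :: 'a. \<phi> (max 0 (norm x - c))"
  have meas: "?g \<in> borel_measurable borel"
    by (rule profile_compose_measurable[OF cont]) (intro continuous_intros, simp)
  show ?thesis
  proof (cases "p = \<infinity>")
    case True
    have "\<bar>?g x\<bar> \<le> \<phi> 0" for x
      using pos[of "max 0 (norm x - c)"] mono[of 0 "max 0 (norm x - c)"] by auto
    then have "esssup lborel (\<lambda>x. ennreal \<bar>?g x\<bar>) \<le> ennreal (\<phi> 0)"
      using meas by (intro esssup_I AE_I2 ennreal_leI) auto
    also have "\<dots> < \<infinity>" by simp
    finally show ?thesis using True meas by (simp add: Lp_space_def)
  next
    case False
    let ?P = "enn2real p"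
    define h where "h = (\<lambda>x :: 'a. ennreal (\<bar>\<phi> (norm x)\<bar> powr ?P))"
    have [measurable]: "(\<lambda>x :: 'a. \<phi> (norm x)) \<in> borel_measurable borel"
      and fin: "(\<integral>\<^sup>+ x. h x \<partial>lborel) < \<infinity>"
      using Lp False by (auto simp: Lp_space_def h_def)
    have h: "h \<in> borel_measurable borel" unfolding h_def by measurable
    have h2: "(\<lambda>x. h ((1/2) *\<^sub>R x)) \<in> borel_measurable lborel"
      unfolding measurable_lborel2 by (rule measurable_compose[OF _ h]) measurable
    have half: "(\<integral>\<^sup>+ x. h ((1/2) *\<^sub>R x) \<partial>lborel) < \<infinity>"
    proof (rule ccontr)
      assume "\<not> ?thesis"
      then have "(\<integral>\<^sup>+ x. h ((1/2) *\<^sub>R x) \<partial>lborel) = top"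
        by (simp only: infinity_ennreal_def top.not_eq_extremum[symmetric] not_not)
      moreover have "(\<integral>\<^sup>+ x. h x \<partial>lborel) =
        ennreal (\<bar>1/2\<bar> ^ DIM('a)) * (\<integral>\<^sup>+ x. h ((1/2) *\<^sub>R x) \<partial>lborel)"
        by (rule nn_integral_lborel_scaleR[OF h]) simp
      ultimately show False
        using fin by (simp add: ennreal_mult_top)
    qed
    let ?K = "ennreal (\<phi> 0 powr ?P)"
    have "(\<integral>\<^sup>+ x. ennreal (\<bar>?g x\<bar> powr ?P) \<partial>lborel) \<le>
        (\<integral>\<^sup>+ x. ?K * indicator (cball 0 (2 * c)) x + h ((1/2) *\<^sub>R x) \<partial>lborel)"
    proof (rule nn_integral_mono)
      fix x :: 'a
      show "ennreal (\<bar>?g x\<bar> powr ?P) \<le> ?K * indicator (cball 0 (2 * c)) x + h ((1/2) *\<^sub>R x)"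
      proof (cases "norm x \<le> 2 * c")
        case True
        have "\<bar>?g x\<bar> powr ?P \<le> \<phi> 0 powr ?P"
          using pos[of "max 0 (norm x - c)"] mono[of 0 "max 0 (norm x - c)"]
          by (intro powr_mono2) auto
        then show ?thesis
          using True by (auto intro!: add_increasing2 ennreal_leI)
      next
        case False
        have "norm x / 2 \<le> max 0 (norm x - c)"
          using False by linarith
        then have "\<phi> (max 0 (norm x - c)) \<le> \<phi> (norm x / 2)"
          by (rule mono[rotated]) simp
        then have "\<bar>?g x\<bar> powr ?P \<le> \<bar>\<phi> (norm ((1/2) *\<^sub>R x))\<bar> powr ?P"
          using pos[of "max 0 (norm x - c)"] pos[of "norm x / 2"] by (intro powr_mono2) auto
        then have "ennreal (\<bar>?g x\<bar> powr ?P) \<le> h ((1/2) *\<^sub>R x)"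
          unfolding h_def by (rule ennreal_leI)
        then show ?thesis
          by (rule add_increasing[OF zero_le])
      qed
    qed
    also have "\<dots> = ?K * emeasure lborel (cball 0 (2 * c) :: 'a set) +
        (\<integral>\<^sup>+ x. h ((1/2) *\<^sub>R x) \<partial>lborel)"
    proof -
      have ball: "cball 0 (2 * c) \<in> sets (lborel :: 'a measure)" by simp
      have "(\<lambda>x :: 'a. ?K * indicator (cball 0 (2 * c)) x) \<in> borel_measurable lborel"
        by (intro borel_measurable_times_ennreal borel_measurable_const
            borel_measurable_indicator ball)
      from nn_integral_add[OF this h2] show ?thesis
        unfolding nn_integral_cmult_indicator[OF ball] .
    qed
    also have "\<dots> < \<infinity>"
    proof -
      have "?K * emeasure lborel (cball 0 (2 * c) :: 'a set) < \<infinity>"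
        using emeasure_lborel_cball_finite[of "0 :: 'a" "2 * c"]
        by (simp add: ennreal_mult_less_top)
      then show ?thesis
        using half unfolding infinity_ennreal_def ennreal_add_less_top by (rule conjI)
    qed
    finally show ?thesis using False meas by (simp add: Lp_space_def)
  qed
qed

lemma profile_infdist_diff_dominated:
  fixes A B :: "'a::euclidean_space set"
  assumes pos: "\<And>t. t \<ge> 0 \<Longrightarrow> \<phi> t > (0::real)"
    and mono: "\<And>s t. 0 \<le> s \<Longrightarrow> s \<le> t \<Longrightarrow> \<phi> t \<le> \<phi> s"
    and A: "A \<subseteq> cball 0 c" "A \<noteq> {}" and B: "B \<subseteq> cball 0 c" "B \<noteq> {}"
  shows "\<bar>\<phi> (infdist x A) - \<phi> (infdist x B)\<bar> \<le> \<phi> (max 0 (norm x - c))"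
proof -
  have "0 < \<phi> (infdist x C) \<and> \<phi> (infdist x C) \<le> \<phi> (max 0 (norm x - c))"
    if "C \<subseteq> cball 0 c" "C \<noteq> {}" for C
    using norm_minus_radius_le_infdist[OF that, of x] infdist_nonneg[of x C]
    by (auto intro!: pos mono)
  from this[OF A] this[OF B] show ?thesis by auto
qed

lemma profile_infdist_diff_in_Lp:
  fixes A B :: "'a::euclidean_space set"
  assumes pos: "\<And>t. t \<ge> 0 \<Longrightarrow> \<phi> t > 0" and mono: "\<And>s t. 0 \<le> s \<Longrightarrow> s \<le> t \<Longrightarrow> \<phi> t \<le> \<phi> s"
    and cont: "continuous_on {0..} \<phi>"
    and Lp: "(\<lambda>x :: 'a. \<phi> (norm x)) \<in> Lp_space lborel p"
    and "bounded A" "A \<noteq> {}" "bounded B" "B \<noteq> {}"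
  shows "(\<lambda>x. \<phi> (infdist x A) - \<phi> (infdist x B)) \<in> Lp_space lborel p"
proof -
  have "bounded (A \<union> B)" using assms by simp
  then obtain c where "\<forall>x\<in>A \<union> B. norm x \<le> c" unfolding bounded_iff by blast
  then have c: "A \<subseteq> cball 0 c" "B \<subseteq> cball 0 c" by auto
  show ?thesis
    using profile_infdist_measurable[OF cont, of A] profile_infdist_measurable[OF cont, of B]
    by (intro Lp_space_dominated[OF shifted_profile_in_Lp[OF pos mono cont Lp, of c]]
        profile_infdist_diff_dominated pos mono c assms) auto
qed

lemma positive_vanishing_uniformly_continuous:
  fixes \<phi> :: "real \<Rightarrow> real"
  assumes pos: "\<And>t. t \<ge> 0 \<Longrightarrow> \<phi> t > 0"
    and cont: "continuous_on {0..} \<phi>" and lim: "(\<phi> \<longlongrightarrow> 0) at_top"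
  shows "uniformly_continuous_on {0..} \<phi>"
proof (unfold uniformly_continuous_on_def, intro allI impI)
  fix e :: real assume e: "e > 0"
  have "eventually (\<lambda>t. \<phi> t < e) at_top"
    using lim e by (auto dest: order_tendstoD)
  then obtain T where T: "\<And>t. t \<ge> T \<Longrightarrow> \<phi> t < e"
    by (auto simp: eventually_at_top_linorder)
  have "uniformly_continuous_on {0..max T 0 + 1} \<phi>"
    by (intro compact_uniformly_continuous continuous_on_subset[OF cont]) auto
  then obtain d where d: "d > 0"
    "\<And>s t. s \<in> {0..max T 0 + 1} \<Longrightarrow> t \<in> {0..max T 0 + 1} \<Longrightarrow> dist t s < d \<Longrightarrow> dist (\<phi> t) (\<phi> s) < e"
    using e unfolding uniformly_continuous_on_def by meson
  \<comment> \<open>Two points closer than \<open>1\<close> either both lie in the compact interval, or both lie beyond \<open>T\<close>,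
    where the values are in \<open>(0, e)\<close>.\<close>
  have "dist (\<phi> t) (\<phi> s) < e" if st: "s \<ge> 0" "t \<ge> 0" "dist t s < min d 1" for s t
  proof (cases "s \<le> max T 0 + 1 \<and> t \<le> max T 0 + 1")
    case True
    then show ?thesis using st d(2)[of s t] by auto
  next
    case False
    then have "s \<ge> T" "t \<ge> T" using st by (auto simp: dist_real_def)
    then show ?thesis
      using T[of s] T[of t] pos[of s] pos[of t] st by (auto simp: dist_real_def)
  qed
  then show "\<exists>d>0. \<forall>x\<in>{0..}. \<forall>x'\<in>{0..}. dist x' x < d \<longrightarrow> dist (\<phi> x') (\<phi> x) < e"
    using d(1) by (intro exI[of _ "min d 1"]) auto
qed

section \<open>Each distance controls the other\<close>

lemma dist_Lp_small_if_hausdorff_small_infinite: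
  fixes A :: "(real ^ 'n) set"
  assumes cont: "uniformly_continuous_on {0..} \<phi>"
    and A: "A \<in> nonempty_compacts" and e: "e > 0"
  shows "\<exists>r>0. \<forall>B\<in>nonempty_compacts. hausdorff_distance A B < r \<longrightarrow> dist_Lp \<infinity> \<phi> A B < e"
proof -
  obtain d where d: "d > 0"
    "\<And>s t. s \<ge> 0 \<Longrightarrow> t \<ge> 0 \<Longrightarrow> dist t s < d \<Longrightarrow> dist (\<phi> t) (\<phi> s) < e / 2"
    using cont half_gt_zero[OF e] unfolding uniformly_continuous_on_def by (metis atLeast_iff)
  have cont': "continuous_on {0..} \<phi>" using cont by (rule uniformly_continuous_imp_continuous)
  have "dist_Lp \<infinity> \<phi> A B < e"
    if B: "B \<in> nonempty_compacts" and less: "hausdorff_distance A B < d / 2" for B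
  proof -
    let ?f = "\<lambda>x. \<phi> (infdist x A) - \<phi> (infdist x B)"
    have "\<bar>?f x\<bar> \<le> e / 2" for x
    proof -
      have "\<bar>infdist x A - infdist x B\<bar> \<le> d / 2"
        using A B less by (intro infdist_diff_le_hausdorff_distance) (auto simp: nonempty_compacts_def)
      then show ?thesis
        using d(2)[of "infdist x B" "infdist x A"] d(1) infdist_nonneg[of x A] infdist_nonneg[of x B]
        by (simp add: dist_real_def)
    qed
    then have "esssup lborel (\<lambda>x. ennreal \<bar>?f x\<bar>) \<le> ennreal (e / 2)"
      using profile_infdist_measurable[OF cont', of A] profile_infdist_measurable[OF cont', of B]
      by (intro esssup_I AE_I2 ennreal_leI) auto
    then have "enn2real (esssup lborel (\<lambda>x. ennreal \<bar>?f x\<bar>)) \<le> e / 2"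
      using e by (intro enn2real_leI) auto
    then show ?thesis using e by (simp add: dist_Lp_def Lp_norm_def)
  qed
  then show ?thesis using d(1) by (intro exI[of _ "d / 2"]) auto
qed

lemma dist_Lp_small_if_hausdorff_small_finite:
  fixes A :: "(real ^ 'n) set"
  assumes p: "1 \<le> p" "p \<noteq> \<infinity>"
    and pos: "\<And>t. t \<ge> 0 \<Longrightarrow> \<phi> t > 0" and mono: "\<And>s t. 0 \<le> s \<Longrightarrow> s \<le> t \<Longrightarrow> \<phi> t \<le> \<phi> s"
    and cont: "continuous_on {0..} \<phi>"
    and Lp: "(\<lambda>x :: real ^ 'n. \<phi> (norm x)) \<in> Lp_space lborel p"
    and A: "A \<in> nonempty_compacts" and e: "e > 0"
  shows "\<exists>r>0. \<forall>B\<in>nonempty_compacts. hausdorff_distance A B < r \<longrightarrow> dist_Lp p \<phi> A B < e"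
proof (rule ccontr)
  assume neg: "\<not> ?thesis"
  have "\<exists>B. B \<in> nonempty_compacts \<and> hausdorff_distance A B < 1 / real (Suc n)
      \<and> \<not> dist_Lp p \<phi> A B < e" for n
    using neg[simplified, rule_format, of "1 / real (Suc n)"] by auto
  then obtain B where B: "\<And>n. B n \<in> nonempty_compacts"
    "\<And>n. hausdorff_distance A (B n) < 1 / real (Suc n)" "\<And>n. \<not> dist_Lp p \<phi> A (B n) < e"
    by metis
  have cA: "compact A" "A \<noteq> {}" and cB: "\<And>n. compact (B n)" "\<And>n. B n \<noteq> {}"
    using A B(1) by (auto simp: nonempty_compacts_def)
  have close: "\<bar>infdist x A - infdist x (B n)\<bar> \<le> 1 / real (Suc n)" for x n
    by (rule infdist_diff_le_hausdorff_distance[OF cA cB B(2)])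
  obtain R where "\<forall>x\<in>A. norm x \<le> R"
    using compact_imp_bounded[OF cA(1)] unfolding bounded_iff by blast
  then have R: "A \<subseteq> cball 0 R" by auto
  \<comment> \<open>All the sets are within distance \<open>1\<close> of \<open>A\<close>, hence in one ball; its radius fixes the
    dominating function.\<close>
  have sub: "B n \<subseteq> cball 0 (R + 1)" for n
  proof
    fix b assume b: "b \<in> B n"
    have "norm b - R \<le> infdist b A" by (rule norm_minus_radius_le_infdist[OF R cA(2)])
    also have "\<dots> \<le> 1 / real (Suc n)" using close[of b n] b by simp
    also have "\<dots> \<le> 1" by simp
    finally show "b \<in> cball 0 (R + 1)" by simp
  qed
  have "(\<lambda>n. Lp_norm lborel p (\<lambda>x. \<phi> (infdist x A) - \<phi> (infdist x (B n)))) \<longlonglongrightarrow> 0"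
  proof (rule Lp_norm_dominated_convergence[OF p
        shifted_profile_in_Lp[OF pos mono cont Lp, of "R + 1"]])
    show "(\<lambda>x. \<phi> (infdist x A) - \<phi> (infdist x (B n))) \<in> borel_measurable lborel" for n
      using profile_infdist_measurable[OF cont, of A] profile_infdist_measurable[OF cont, of "B n"]
      by simp
    show "\<bar>\<phi> (infdist x A) - \<phi> (infdist x (B n))\<bar> \<le> \<phi> (max 0 (norm x - (R + 1)))" for n x
      using R sub by (intro profile_infdist_diff_dominated pos mono cA cB) auto
    show "(\<lambda>n. \<phi> (infdist x A) - \<phi> (infdist x (B n))) \<longlonglongrightarrow> 0" for x
    proof -
      have "(\<lambda>n. infdist x (B n) - infdist x A) \<longlonglongrightarrow> 0"
        by (rule Lim_null_comparison[OF _ LIMSEQ_Suc[OF lim_1_over_n]])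
           (use close[of x] in \<open>auto simp: abs_minus_commute\<close>)
      then have "(\<lambda>n. infdist x (B n)) \<longlonglongrightarrow> infdist x A" by (simp add: LIM_zero_iff)
      then have "(\<lambda>n. \<phi> (infdist x (B n))) \<longlonglongrightarrow> \<phi> (infdist x A)"
        by (intro continuous_on_tendsto_compose[OF cont]) (auto simp: infdist_nonneg)
      from tendsto_diff[OF tendsto_const[of "\<phi> (infdist x A)"] this] show ?thesis by simp
    qed
  qed simp_all
  then have "eventually (\<lambda>n. dist_Lp p \<phi> A (B n) < e) sequentially"
    using e by (auto simp: dist_Lp_def dest: order_tendstoD)
  with B(3) show False by (auto simp: eventually_sequentially)
qed

text \<open>Around \<open>a\<close> the two distance functions are separated on a whole ball of radius \<open>e / 4\<close>. The
  volume of this ball does not depend on its centre, so the bound depends only on \<open>e\<close> and not on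
  the position of \<open>a\<close>. The hypothesis is symmetric in \<open>A\<close> and \<open>B\<close>, so it
  covers both ways in which a Hausdorff distance can be large.\<close>

lemma dist_Lp_lower_bound:
  fixes A B :: "(real ^ 'n) set"
  assumes p: "1 \<le> p" and e: "e > 0"
    and strict: "\<phi> (3 * e / 4) < \<phi> (e / 4)"
    and mono: "\<And>s t. 0 \<le> s \<Longrightarrow> s \<le> t \<Longrightarrow> \<phi> t \<le> \<phi> s"
    and Lp: "(\<lambda>x. \<phi> (infdist x A) - \<phi> (infdist x B)) \<in> Lp_space lborel p"
    and far: "a \<in> A \<and> e \<le> infdist a B \<or> a \<in> B \<and> e \<le> infdist a A"
  defines "\<eta> \<equiv> \<phi> (e / 4) - \<phi> (3 * e / 4)"
  shows "(if p = \<infinity> then \<eta> else \<eta> * measure lborel (ball (0 :: real ^ 'n) (e / 4)) powr (1 / enn2real p))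
    \<le> dist_Lp p \<phi> A B"
proof -
  have gap: "\<eta> \<le> \<phi> (infdist x C) - \<phi> (infdist x D)"
    if "a \<in> C" "e \<le> infdist a D" "x \<in> ball a (e / 4)" for x and C D :: "(real ^ 'n) set"
  proof -
    have "infdist x C \<le> e / 4"
      using infdist_le[OF that(1), of x] that(3) by (simp add: dist_commute)
    moreover have "infdist x D \<ge> 3 * e / 4"
      using infdist_triangle[of a D x] that by simp
    ultimately show ?thesis
      using mono[of "infdist x C" "e / 4"] mono[of "3 * e / 4" "infdist x D"] e
        infdist_nonneg[of x C] by (simp add: \<eta>_def)
  qed
  have "measure lborel (ball a (e / 4)) = measure lborel (ball (0 :: real ^ 'n) (e / 4))"
    using e by (simp add: content_ball)
  moreover have "0 \<le> \<eta>" using strict by (simp add: \<eta>_def)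
  moreover have "\<eta> \<le> \<bar>\<phi> (infdist x A) - \<phi> (infdist x B)\<bar>" if "x \<in> ball a (e / 4)" for x
    using far gap[of A B x] gap[of B A x] that by auto
  ultimately show ?thesis
    using Lp_norm_ge_on_set[OF p Lp, of "ball a (e / 4)" \<eta>] e content_ball_pos[of "e / 4" a]
    by (cases "p = \<infinity>") (simp_all add: dist_Lp_def)
qed

lemma hausdorff_small_if_dist_Lp_small:
  fixes A :: "(real ^ 'n) set"
  assumes p: "1 \<le> p"
    and pos: "\<And>t. t \<ge> 0 \<Longrightarrow> \<phi> t > 0" and strict: "strict_antimono_on {0..} \<phi>"
    and cont: "continuous_on {0..} \<phi>"
    and Lp: "(\<lambda>x :: real ^ 'n. \<phi> (norm x)) \<in> Lp_space lborel p"
    and A: "A \<in> nonempty_compacts" and e: "e > 0"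
  shows "\<exists>r>0. \<forall>B\<in>nonempty_compacts. dist_Lp p \<phi> A B < r \<longrightarrow> hausdorff_distance A B < e"
proof -
  have mono: "\<phi> t \<le> \<phi> s" if "0 \<le> s" "s \<le> t" for s t
    using strict that by (cases "s = t") (auto simp: monotone_on_def intro: less_imp_le)
  define e' where "e' = e / 2"
  have e': "e' > 0" using e by (simp add: e'_def)
  define \<eta> where "\<eta> = \<phi> (e' / 4) - \<phi> (3 * e' / 4)"
  have eta: "\<phi> (3 * e' / 4) < \<phi> (e' / 4)"
    using strict e' by (auto simp: monotone_on_def)
  define r where
    "r = (if p = \<infinity> then \<eta> else \<eta> * measure lborel (ball (0 :: real ^ 'n) (e' / 4)) powr (1 / enn2real p))"
  have "r > 0"
    using eta e' content_ball_pos[of "e' / 4" "0 :: real ^ 'n"] by (simp add: r_def \<eta>_def)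
  moreover have "hausdorff_distance A B < e"
    if B: "B \<in> nonempty_compacts" and less: "dist_Lp p \<phi> A B < r" for B
  proof -
    have c: "compact A" "A \<noteq> {}" "compact B" "B \<noteq> {}"
      using A B by (auto simp: nonempty_compacts_def)
    have "(\<lambda>x. \<phi> (infdist x A) - \<phi> (infdist x B)) \<in> Lp_space lborel p"
      using c by (intro profile_infdist_diff_in_Lp pos mono cont Lp) (auto intro: compact_imp_bounded)
    then have "\<not> (a \<in> A \<and> e' \<le> infdist a B \<or> a \<in> B \<and> e' \<le> infdist a A)" for a
      using dist_Lp_lower_bound[OF p e' eta mono, of A B a] less unfolding r_def \<eta>_def by force
    then have "hausdorff_distance A B \<le> e'"
      using c e' by (intro hausdorff_distance_le) (auto intro: compact_imp_closed less_imp_le simp: not_le)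
    then show ?thesis using e by (simp add: e'_def)
  qed
  ultimately show ?thesis by blast
qed

section \<open>Coincidence of the topologies\<close>

theorem theorem3p10:
  fixes p :: ennreal and \<phi> :: "real \<Rightarrow> real"
  assumes "1 \<le> p"
    and "admissible TYPE('n::finite) p \<phi>"
  shows "metric_topology (nonempty_compacts :: (real ^ 'n) set set) (dist_Lp p \<phi>) =
         metric_topology (nonempty_compacts :: (real ^ 'n) set set) hausdorff_distance"
proof -
  have pos: "\<And>t. t \<ge> 0 \<Longrightarrow> \<phi> t > 0" and strict: "strict_antimono_on {0..} \<phi>"
    and Lp: "(\<lambda>x :: real ^ 'n. \<phi> (norm x)) \<in> Lp_space lborel p"
    and lim: "p = \<infinity> \<Longrightarrow> (\<phi> \<longlongrightarrow> 0) at_top"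
    and C1: "\<exists>\<phi>'. \<forall>t\<ge>0. (\<phi> has_real_derivative \<phi>' t) (at t within {0..})"
    using assms(2) by (auto simp: admissible_def)
  have cont: "continuous_on {0..} \<phi>"
    using C1 by (auto intro: DERIV_continuous_on)
  have mono: "\<phi> t \<le> \<phi> s" if "0 \<le> s" "s \<le> t" for s t
    using strict that by (cases "s = t") (auto simp: monotone_on_def intro: less_imp_le)
  show ?thesis
  proof (rule metric_topology_eqI)
    fix A :: "(real ^ 'n) set" and e :: real
    assume A: "A \<in> nonempty_compacts" and e: "e > 0"
    show "\<exists>r>0. \<forall>B\<in>nonempty_compacts. dist_Lp p \<phi> A B < r \<longrightarrow> hausdorff_distance A B < e"
      by (rule hausdorff_small_if_dist_Lp_small[OF assms(1) pos strict cont Lp A e])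
    show "\<exists>r>0. \<forall>B\<in>nonempty_compacts. hausdorff_distance A B < r \<longrightarrow> dist_Lp p \<phi> A B < e"
    proof (cases "p = \<infinity>")
      case True
      have "uniformly_continuous_on {0..} \<phi>"
        by (rule positive_vanishing_uniformly_continuous[OF pos cont lim[OF True]])
      from dist_Lp_small_if_hausdorff_small_infinite[OF this A e] True show ?thesis by simp
    next
      case False
      show ?thesis
        by (rule dist_Lp_small_if_hausdorff_small_finite[OF assms(1) False pos mono cont Lp A e])
    qed
  qed
qed

end
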